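(* (Emergence of collective decay rates in the Markovian limit.) Fix $J_0>0$, $\theta>0$ and $t>0$, and put $\gamma_0=2J_0$. For $L>0$ let $\Omega=\theta/L$ and let $$e_1(t)=-\sum_{n=0}^\infty\frac{(\tau_nJ_0)^{2n+1}}{(2n+1)!}e^{-(J_0+i\Omega)\tau_n}\Theta(\tau_n),\qquad \tau_n=t-(2n+1)L,$$ be the excitation amplitude of the initially unexcited qubit in the two-qubit problem. Then in the Markovian limit $L\to0^+$ (so that $J_0L\to0$ with $\Omega L=\theta$ fixed), $$e_1(t)\approx\frac{e^{-i\Omega t}}{2}\left(e^{-\frac{\Gamma_1}{2}t}-e^{-\frac{\Gamma_2}{2}t}\right),\qquad \Gamma_1=\gamma_0(1+e^{i\theta}),\quad \Gamma_2=\gamma_0(1-e^{i\theta}),$$ in the sense that $e^{i\Omega t}e_1(t)\to\tfrac12\left(e^{-\Gamma_1t/2}-e^{-\Gamma_2t/2}\right)$.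
   Context: Two identical qubits with transition energy $\Omega$ and single-emitter decay rate $\gamma_0=2J_0$ are point-coupled to a one-dimensional waveguide ($\hbar=v_g=1$) at distance $L$ from each other. One is initially excited, and $e_1(t)$ is the exact excitation amplitude of the other. $\Theta$ is the Heaviside function. $\theta=\Omega L$ is the propagation phase, and $\Gamma_{1},\Gamma_2$ are called the collective decay rates. *)

theory Defs
  imports "HOL-Analysis.Analysis"
begin

(* The value at 0 is immaterial below: there the step function always
   multiplies an odd, hence positive, power of its own argument. *)
definition heaviside :: "real \<Rightarrow> real" where
  "heaviside x = (if x \<ge> 0 then 1 else 0)"

definition delay :: "real \<Rightarrow> real \<Rightarrow> nat \<Rightarrow> real" where
  "delay L t n = t - (2 * real n + 1) * L"

definition excitation_term :: "real \<Rightarrow> real \<Rightarrow> real \<Rightarrow> real \<Rightarrow> nat \<Rightarrow> complex" where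
  "excitation_term J\<^sub>0 \<Omega> L t n =
     of_real ((delay L t n * J\<^sub>0) ^ (2 * n + 1) / fact (2 * n + 1))
     * exp (- ((of_real J\<^sub>0 + \<i> * of_real \<Omega>) * of_real (delay L t n)))
     * of_real (heaviside (delay L t n))"

definition excitation_amplitude :: "real \<Rightarrow> real \<Rightarrow> real \<Rightarrow> real \<Rightarrow> complex" where
  "excitation_amplitude J\<^sub>0 \<Omega> L t = - (\<Sum>n. excitation_term J\<^sub>0 \<Omega> L t n)"

(* For positive L only finitely many terms are nonzero, by causality, so the
   series above is a genuine sum. *)
lemma summable_excitation_term:
  assumes "L > 0"
  shows "summable (excitation_term J\<^sub>0 \<Omega> L t)"
proof -
  obtain N :: nat where N: "real N > t / L"
    using reals_Archimedean2 by blast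
  have "excitation_term J\<^sub>0 \<Omega> L t n = 0" if "n \<notin> {..<N}" for n
  proof -
    have "real N \<le> 2 * real n + 1" using that by auto
    with N have "t / L < 2 * real n + 1" by linarith
    hence "delay L t n < 0"
      using assms by (simp add: delay_def field_simps)
    thus ?thesis by (simp add: excitation_term_def heaviside_def)
  qed
  thus ?thesis by (intro summable_finite[of "{..<N}"]) auto
qed

definition collective_rate1 :: "real \<Rightarrow> real \<Rightarrow> complex" where
  "collective_rate1 \<gamma>\<^sub>0 \<theta> = of_real \<gamma>\<^sub>0 * (1 + exp (\<i> * of_real \<theta>))"

definition collective_rate2 :: "real \<Rightarrow> real \<Rightarrow> complex" where
  "collective_rate2 \<gamma>\<^sub>0 \<theta> = of_real \<gamma>\<^sub>0 * (1 - exp (\<i> * of_real \<theta>))"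

end

(* In the frame rotating with the qubit frequency, the phase of the n-th term is
   exp (i Omega (t - tau_n)) = exp (i theta)^(2n+1), which no longer depends on L.  Each term then
   converges as L tends to 0, and the series is dominated by that of sinh (J0 t), so Tannery's
   theorem gives the limit -exp (-J0 t) sinh (J0 t exp (i theta)). *)

theory Submission
  imports Defs
begin

text \<open>The even coefficients of the sinh series vanish, so restricting it to the indices
  \<open>2 * n + 1\<close> leaves the sum unchanged.\<close>

lemma sinh_odd_series:
  fixes x :: "'a::{banach, real_normed_field}"
  shows "(\<lambda>n. x ^ (2 * n + 1) / fact (2 * n + 1)) sums sinh x"
proof -
  have sm: "strict_mono (\<lambda>n::nat. 2 * n + 1)"
    by (auto simp: strict_mono_def)
  \<comment> \<open>The conditional never takes its first branch. It is kept so that the summand is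
    literally the full series evaluated at \<open>2 * n + 1\<close>, the shape in which reindexing
    applies.\<close>
  have "(\<lambda>n. if even (2 * n + 1) then 0 else x ^ (2 * n + 1) /\<^sub>R fact (2 * n + 1)) sums sinh x"
    using sinh_converges[of x]
    by (subst sums_mono_reindex[OF sm, where f = "\<lambda>n. if even n then 0 else x ^ n /\<^sub>R fact n"])
       (metis (lifting) oddE rangeI, simp)
  then show ?thesis
    by (simp add: scaleR_conv_of_real divide_inverse mult.commute del: power_Suc fact_Suc)
qed

text \<open>The phase is an odd multiple of \<open>\<theta>\<close>, with the same factor
  \<open>2 * n + 1\<close> as the exponent of the power, so it can be absorbed into the base. This
  gives a term of a sinh series with complex argument, in which \<open>L\<close> enters only through
  the delay.\<close>

lemma rotating_excitation_term:
  assumes "L \<noteq> 0" and "\<Omega> * L = \<theta>"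
  shows "exp (\<i> * of_real \<Omega> * of_real t) * excitation_term J\<^sub>0 \<Omega> L t n =
    (of_real (delay L t n * J\<^sub>0) * exp (\<i> * of_real \<theta>)) ^ (2 * n + 1) / fact (2 * n + 1)
    * of_real (exp (- (J\<^sub>0 * delay L t n)) * heaviside (delay L t n))"
proof -
  define \<tau> where "\<tau> = delay L t n"
  have "\<Omega> * (t - \<tau>) = of_nat (2 * n + 1) * \<theta>"
    unfolding \<tau>_def delay_def assms(2)[symmetric] by (simp add: algebra_simps)
  then have eq: "complex_of_real (\<Omega> * (t - \<tau>)) = of_real (of_nat (2 * n + 1) * \<theta>)"
    by (rule arg_cong)
  \<comment> \<open>Separates the oscillation, which sees only \<open>t - \<tau>\<close>, from the
    real damping.\<close>
  have "\<i> * of_real \<Omega> * of_real t + - ((of_real J\<^sub>0 + \<i> * of_real \<Omega>) * of_real \<tau>)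
      = \<i> * of_real (\<Omega> * (t - \<tau>)) + of_real (- (J\<^sub>0 * \<tau>))"
    by (simp add: algebra_simps)
  then have phase: "\<i> * of_real \<Omega> * of_real t + - ((of_real J\<^sub>0 + \<i> * of_real \<Omega>) * of_real \<tau>)
      = of_nat (2 * n + 1) * (\<i> * of_real \<theta>) + of_real (- (J\<^sub>0 * \<tau>))"
    unfolding eq by (simp add: mult_ac)
  have exps: "exp (\<i> * of_real \<Omega> * of_real t) * exp (- ((of_real J\<^sub>0 + \<i> * of_real \<Omega>) * of_real \<tau>))
      = exp (\<i> * of_real \<theta>) ^ (2 * n + 1) * of_real (exp (- (J\<^sub>0 * \<tau>)))"
    unfolding exp_add[symmetric] phase by (simp only: exp_add exp_of_nat_mult exp_of_real)
  have "exp (\<i> * of_real \<Omega> * of_real t) * excitation_term J\<^sub>0 \<Omega> L t n =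
      of_real ((\<tau> * J\<^sub>0) ^ (2 * n + 1) / fact (2 * n + 1))
      * (exp (\<i> * of_real \<Omega> * of_real t) * exp (- ((of_real J\<^sub>0 + \<i> * of_real \<Omega>) * of_real \<tau>)))
      * of_real (heaviside \<tau>)"
    unfolding excitation_term_def \<tau>_def[symmetric] by (simp only: mult_ac)
  then show ?thesis
    unfolding exps \<tau>_def[symmetric] by (simp add: power_mult_distrib del: power_Suc fact_Suc)
qed

text \<open>Phases have modulus one. For a nonnegative delay the damping is at most 1 and the delay
  at most \<open>t\<close>; for a negative one the step function removes the term. The majorant is
  free of \<open>L\<close>, as dominated summation requires.\<close>

lemma norm_rotating_excitation_term_le:
  assumes "J\<^sub>0 \<ge> 0" and "L \<ge> 0" and "t \<ge> 0"
  shows "norm (exp (\<i> * of_real \<Omega> * of_real t) * excitation_term J\<^sub>0 \<Omega> L t n)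
    \<le> (t * J\<^sub>0) ^ (2 * n + 1) / fact (2 * n + 1)"
proof (cases "delay L t n \<ge> 0")
  case True
  have le: "delay L t n \<le> t"
    using assms by (simp add: delay_def)
  have pow: "(delay L t n * J\<^sub>0) ^ (2 * n + 1) \<le> (t * J\<^sub>0) ^ (2 * n + 1)"
    using True le assms by (intro power_mono mult_right_mono mult_nonneg_nonneg)
  have "norm (exp (\<i> * of_real \<Omega> * of_real t) * excitation_term J\<^sub>0 \<Omega> L t n)
      = (delay L t n * J\<^sub>0) ^ (2 * n + 1) / fact (2 * n + 1) * exp (- (J\<^sub>0 * delay L t n))"
    using True assms
    by (simp add: excitation_term_def heaviside_def norm_mult norm_divide norm_power abs_mult
        del: power_Suc fact_Suc)
  also have "\<dots> \<le> (t * J\<^sub>0) ^ (2 * n + 1) / fact (2 * n + 1) * 1"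
    using True assms pow by (intro mult_mono divide_right_mono) auto
  finally show ?thesis by simp
next
  case False
  then show ?thesis
    using assms by (simp add: excitation_term_def heaviside_def del: power_Suc fact_Suc)
qed

theorem mainTheorem4:
  fixes J\<^sub>0 \<theta> t \<gamma>\<^sub>0 :: real and \<Omega> :: "real \<Rightarrow> real"
  assumes "J\<^sub>0 > 0" and "\<theta> > 0" and "t > 0"
    and "\<gamma>\<^sub>0 = 2 * J\<^sub>0"
    and "\<And>L. L > 0 \<Longrightarrow> \<Omega> L = \<theta> / L"
  shows "((\<lambda>L. exp (\<i> * of_real (\<Omega> L) * of_real t) * excitation_amplitude J\<^sub>0 (\<Omega> L) L t)
          \<longlongrightarrow> (exp (- (collective_rate1 \<gamma>\<^sub>0 \<theta> / 2) * of_real t)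
                - exp (- (collective_rate2 \<gamma>\<^sub>0 \<theta> / 2) * of_real t)) / 2) (at_right 0)"
proof -
  \<comment> \<open>\<open>z\<close> is the base of the odd power with the delay replaced by its
    limit \<open>t\<close>, and \<open>b n\<close> is the resulting limit of the n-th term.\<close>
  define z :: complex where "z = of_real (t * J\<^sub>0) * exp (\<i> * of_real \<theta>)"
  define a where "a n L = exp (\<i> * of_real (\<Omega> L) * of_real t) * excitation_term J\<^sub>0 (\<Omega> L) L t n"
    for n L
  define b :: "nat \<Rightarrow> complex"
    where "b n = z ^ (2 * n + 1) / fact (2 * n + 1) * of_real (exp (- (J\<^sub>0 * t)))" for n
  have pos: "eventually (\<lambda>L::real. L > 0) (at_right 0)"
    by (rule eventually_at_right_less)
  have lim: "(a n \<longlongrightarrow> b n) (at_right 0)" for n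
  proof -
    have delay_lim: "((\<lambda>L. delay L t n) \<longlongrightarrow> t) (at_right 0)"
      unfolding delay_def by (auto intro!: tendsto_eq_intros)
    have "((\<lambda>L. (of_real (delay L t n * J\<^sub>0) * exp (\<i> * of_real \<theta>)) ^ (2 * n + 1) / fact (2 * n + 1)
        * complex_of_real (exp (- (J\<^sub>0 * delay L t n)))) \<longlongrightarrow> b n) (at_right 0)"
      unfolding b_def z_def by (intro tendsto_intros delay_lim) (rule fact_nonzero)
    \<comment> \<open>For fixed \<open>n\<close> the step function equals 1 once
      \<open>(2 * n + 1) * L < t\<close>. This threshold shrinks as \<open>n\<close> grows, so the
      convergence of the terms alone does not give that of the sum.\<close>
    moreover have "eventually (\<lambda>L. delay L t n > 0) (at_right 0)"
      using delay_lim \<open>t > 0\<close> by (rule order_tendstoD)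
    then have "eventually (\<lambda>L. (of_real (delay L t n * J\<^sub>0) * exp (\<i> * of_real \<theta>)) ^ (2 * n + 1)
        / fact (2 * n + 1) * complex_of_real (exp (- (J\<^sub>0 * delay L t n))) = a n L) (at_right 0)"
      using pos
    proof eventually_elim
      case (elim L)
      then have "\<Omega> L * L = \<theta>"
        using assms(5) by simp
      with elim show ?case
        unfolding a_def by (subst rotating_excitation_term) (auto simp: heaviside_def)
    qed
    ultimately show ?thesis
      by (rule Lim_transform_eventually)
  qed
  have bound: "eventually (\<lambda>(n, L). norm (a n L) \<le> (t * J\<^sub>0) ^ (2 * n + 1) / fact (2 * n + 1))
      (at_top \<times>\<^sub>F at_right 0)"
    unfolding eventually_prod_filter
  proof (intro exI conjI allI impI)
    show "eventually (\<lambda>_::nat. True) at_top" by simp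
    show "eventually (\<lambda>L::real. L > 0) (at_right 0)" by (fact pos)
    show "case (n, L) of (n, L) \<Rightarrow> norm (a n L) \<le> (t * J\<^sub>0) ^ (2 * n + 1) / fact (2 * n + 1)"
      if "L > 0" for n L
      unfolding a_def case_prod_conv using that assms(1,3)
      by (intro norm_rotating_excitation_term_le) auto
  qed
  have b_sums: "b sums (sinh z * of_real (exp (- (J\<^sub>0 * t))))"
    unfolding b_def by (intro sums_mult2 sinh_odd_series)
  have "((\<lambda>L. \<Sum>n. a n L) \<longlongrightarrow> sinh z * of_real (exp (- (J\<^sub>0 * t)))) (at_right 0)"
    using tannerys_theorem[OF lim bound sums_summable[OF sinh_odd_series]] sums_unique[OF b_sums]
    by simp
  then have "((\<lambda>L. - (\<Sum>n. a n L)) \<longlongrightarrow> - (sinh z * of_real (exp (- (J\<^sub>0 * t))))) (at_right 0)"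
    by (rule tendsto_minus)
  \<comment> \<open>Pulling the phase out of the series needs summability, which causality provides
    for \<open>L > 0\<close>.\<close>
  moreover have "eventually (\<lambda>L. - (\<Sum>n. a n L) =
      exp (\<i> * of_real (\<Omega> L) * of_real t) * excitation_amplitude J\<^sub>0 (\<Omega> L) L t) (at_right 0)"
    using pos unfolding a_def excitation_amplitude_def
    by eventually_elim (simp add: suminf_mult summable_excitation_term)
  ultimately have "((\<lambda>L. exp (\<i> * of_real (\<Omega> L) * of_real t) * excitation_amplitude J\<^sub>0 (\<Omega> L) L t)
      \<longlongrightarrow> - (sinh z * of_real (exp (- (J\<^sub>0 * t))))) (at_right 0)"
    by (rule Lim_transform_eventually)
  also have "- (sinh z * of_real (exp (- (J\<^sub>0 * t)))) =
      (exp (- (collective_rate1 \<gamma>\<^sub>0 \<theta> / 2) * of_real t)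
        - exp (- (collective_rate2 \<gamma>\<^sub>0 \<theta> / 2) * of_real t)) / 2"
  proof -
    have rate1: "collective_rate1 \<gamma>\<^sub>0 \<theta> / 2 = of_real J\<^sub>0 * (1 + exp (\<i> * of_real \<theta>))"
      and rate2: "collective_rate2 \<gamma>\<^sub>0 \<theta> / 2 = of_real J\<^sub>0 * (1 - exp (\<i> * of_real \<theta>))"
      by (simp_all add: collective_rate1_def collective_rate2_def assms(4))
    \<comment> \<open>Both exponents share the damping \<open>- (J\<^sub>0 * t)\<close> and differ
      only in the sign of \<open>z\<close>. Since the first rate carries \<open>- z\<close>, half
      the difference of the exponentials is minus the sinh.\<close>
    have "- (collective_rate1 \<gamma>\<^sub>0 \<theta> / 2) * of_real t = of_real (- (J\<^sub>0 * t)) + - z"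
      and "- (collective_rate2 \<gamma>\<^sub>0 \<theta> / 2) * of_real t = of_real (- (J\<^sub>0 * t)) + z"
      unfolding rate1 rate2 z_def by (simp_all add: algebra_simps)
    then show ?thesis
      by (simp only: exp_add exp_of_real sinh_field_def) (simp add: field_simps)
  qed
  finally show ?thesis .
qed

end
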